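(* Let $M\in\mathbb{R}^{m\times n}$ and assume that $\Omega\in\mathbb{R}^{d\times m}$ is an $\epsilon$-embedding of $\mathrm{range}(M)$. Let $M^{sk}=\Omega M$. For any permutation matrix $\Pi\in\mathbb{R}^{n\times n}$, consider the ($k$-)partial QR factorizations of $M\Pi$ and $M^{sk}\Pi$, with partial $R$ factors $$\mathcal{R}_k(M\Pi)=\begin{pmatrix}R_{11}&R_{12}\\0&R_{22}\end{pmatrix}\quad\text{and}\quad\mathcal{R}_k(M^{sk}\Pi)=\begin{pmatrix}R^{sk}_{11}&R^{sk}_{12}\\0&R^{sk}_{22}\end{pmatrix},$$ where $R_{11},R_{11}^{sk}\in\mathbb{R}^{k\times k}$. Then for all $1\le j\le n-k$, $$\frac{1}{1+\epsilon}\,\gamma_j^2(R^{sk}_{22})\le\gamma_j^2(R_{22})\le\frac{1}{1-\epsilon}\,\gamma_j^2(R^{sk}_{22}).$$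
   Context: All matrices are real. $\gamma_j(B)$ denotes the 2-norm of the $j$-th column of the matrix $B$. $\epsilon$-embedding: $\Omega\in\mathbb{R}^{d\times m}$ is an $\epsilon$-embedding of a subspace $V\subset\mathbb{R}^m$ if $|\langle\Omega x,\Omega y\rangle-\langle x,y\rangle|\le\epsilon\|x\|_2\|y\|_2$ for all $x,y\in V$; $\epsilon$ is the distortion parameter. Partial QR factorization: for $A\in\mathbb{R}^{p\times n}$, a factorization $A=QR$ with $Q\in\mathbb{R}^{p\times p}$ orthogonal and $R=\begin{pmatrix}R_{11}&R_{12}\\0&R_{22}\end{pmatrix}$, where $R_{11}\in\mathbb{R}^{k\times k}$ is upper triangular, and $R_{12}\in\mathbb{R}^{k\times(n-k)}$, $R_{22}\in\mathbb{R}^{(p-k)\times(n-k)}$ are general matrices. The partial $R$ factor $R$ of this factorization is denoted $\mathcal{R}_k(A)$.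
   Formalization: The formal theorem additionally assumes ε < 1 and that R₁₁ is invertible (the first k columns of MΠ are linearly independent); otherwise 1/(1−ε) is undefined or negative, or the column norms of R₂₂ depend on the choice of Q and the claim fails. *)

theory Defs
  imports "Jordan_Normal_Form.VS_Connect" "HOL-Combinatorics.Permutations"
begin

definition vnorm :: "real vec \<Rightarrow> real" where
  "vnorm v = sqrt (v \<bullet> v)"

text \<open>Columns are numbered from 1, as in the mathematical text, whereas \<^const>\<open>col\<close> counts from 0.\<close>
definition colnorm :: "nat \<Rightarrow> real mat \<Rightarrow> real" where
  "colnorm j B = vnorm (col B (j - 1))"

definition eps_embedding :: "real \<Rightarrow> real mat \<Rightarrow> real vec set \<Rightarrow> bool" where
  "eps_embedding \<epsilon> \<Omega> V \<longleftrightarrow>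
     subspace class_ring V (module_vec TYPE(real) (dim_col \<Omega>)) \<and>
     (\<forall>x\<in>V. \<forall>y\<in>V. \<bar>(\<Omega> *\<^sub>v x) \<bullet> (\<Omega> *\<^sub>v y) - x \<bullet> y\<bar> \<le> \<epsilon> * vnorm x * vnorm y)"

definition permutation_matrix :: "nat \<Rightarrow> real mat \<Rightarrow> bool" where
  "permutation_matrix n P \<longleftrightarrow>
     (\<exists>\<pi>. \<pi> permutes {..<n} \<and> P = mat n n (\<lambda>(i, j). if i = \<pi> j then 1 else 0))"

text \<open>The library's \<^const>\<open>orthogonal_mat\<close> only asks for pairwise orthogonal nonzero columns of
  arbitrary length, so orthogonality of \<open>Q\<close> is stated directly.\<close>
definition partial_QR ::
  "nat \<Rightarrow> real mat \<Rightarrow> real mat \<Rightarrow> real mat \<Rightarrow> real mat \<Rightarrow> real mat \<Rightarrow> bool" where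
  "partial_QR k A Q R\<^sub>1\<^sub>1 R\<^sub>1\<^sub>2 R\<^sub>2\<^sub>2 \<longleftrightarrow>
     (let p = dim_row A; n = dim_col A in
        k \<le> p \<and> k \<le> n \<and>
        Q \<in> carrier_mat p p \<and> transpose_mat Q * Q = 1\<^sub>m p \<and>
        R\<^sub>1\<^sub>1 \<in> carrier_mat k k \<and> upper_triangular R\<^sub>1\<^sub>1 \<and>
        R\<^sub>1\<^sub>2 \<in> carrier_mat k (n - k) \<and>
        R\<^sub>2\<^sub>2 \<in> carrier_mat (p - k) (n - k) \<and>
        A = Q * four_block_mat R\<^sub>1\<^sub>1 R\<^sub>1\<^sub>2 (0\<^sub>m (p - k) k) R\<^sub>2\<^sub>2)"

text \<open>The partial R factor depends on the choice of \<open>Q\<close> (also when \<open>R\<^sub>1\<^sub>1\<close> is invertible, where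
  left multiplication of \<open>R\<^sub>2\<^sub>2\<close> by any orthogonal matrix is possible), so it is rendered as a relation
  between \<open>A\<close> and the blocks of the factor rather than as a function of \<open>A\<close>.\<close>
definition partial_R_factor ::
  "nat \<Rightarrow> real mat \<Rightarrow> real mat \<Rightarrow> real mat \<Rightarrow> real mat \<Rightarrow> bool" where
  "partial_R_factor k A R\<^sub>1\<^sub>1 R\<^sub>1\<^sub>2 R\<^sub>2\<^sub>2 \<longleftrightarrow> (\<exists>Q. partial_QR k A Q R\<^sub>1\<^sub>1 R\<^sub>1\<^sub>2 R\<^sub>2\<^sub>2)"

end

theory Submission
  imports Defs
begin

text \<open>
  In a partial QR factorization of \<open>A\<close>, write a vector as \<open>z\<close> followed by \<open>u\<close>, with \<open>z\<close> holding the
  first \<open>k\<close> coordinates. Since \<open>Q\<close> preserves norms, the squared norm of \<open>A (z, u)\<close> is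
  \<open>|R\<^sub>1\<^sub>1 z + R\<^sub>1\<^sub>2 u|\<^sup>2 + |R\<^sub>2\<^sub>2 u|\<^sup>2\<close>. If \<open>R\<^sub>1\<^sub>1\<close> is nonsingular, the first term can be made to vanish
  by the choice of \<open>z\<close>, so \<open>|R\<^sub>2\<^sub>2 u|\<^sup>2\<close> is the minimum over \<open>z\<close> of \<open>|A (z, u)|\<^sup>2\<close>. For a unit vector
  \<open>u\<close> this says that a column norm of \<open>R\<^sub>2\<^sub>2\<close> is the distance of a column of \<open>A\<close> from the span of
  the first \<open>k\<close> columns. In this form the quantity does not depend on the choice of \<open>Q\<close>.

  Minima are monotone: a bound \<open>|B x|\<^sup>2 \<le> c |A x|\<^sup>2\<close> for all \<open>x\<close> passes to the minima over \<open>z\<close>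
  (lemma \<open>trailing_block_mono\<close>). The embedding property gives such bounds between \<open>M \<Pi>\<close> and
  \<open>\<Omega> M \<Pi>\<close> in both directions, with constants \<open>1 + \<epsilon>\<close> and \<open>1 / (1 - \<epsilon>)\<close>, hence both inequalities
  of the theorem. The direction in which the sketched minimum must be attained needs \<open>Rsk\<^sub>1\<^sub>1\<close> to be
  nonsingular. This follows from the nonsingularity of \<open>R\<^sub>1\<^sub>1\<close>, because for \<open>\<epsilon> < 1\<close> the sketch of a
  nonzero vector of the range of \<open>M\<close> is nonzero (lemma \<open>leading_block_det_transfer\<close>).
\<close>

lemma scalar_prod_self_nonneg: "0 \<le> (v :: real vec) \<bullet> v"
  by (auto simp: scalar_prod_def intro: sum_nonneg)

lemma scalar_prod_self_eq_0:
  assumes "(v :: real vec) \<in> carrier_vec n" and "v \<bullet> v = 0"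
  shows "v = 0\<^sub>v n"
  using assms conjugate_square_eq_0_vec[of v n]
  by (simp add: scalar_prod_def)

lemma vnorm_square: "(vnorm v)\<^sup>2 = v \<bullet> v"
  by (simp add: vnorm_def scalar_prod_self_nonneg)

lemma colnorm_square:
  assumes "B \<in> carrier_mat nr nc" and "1 \<le> j" and "j \<le> nc"
  shows "(colnorm j B)\<^sup>2 = (B *\<^sub>v unit_vec nc (j - 1)) \<bullet> (B *\<^sub>v unit_vec nc (j - 1))"
proof -
  have "B *\<^sub>v unit_vec nc (j - 1) = col B (j - 1)"
    using assms by (intro eq_vecI) auto
  then show ?thesis by (simp add: colnorm_def vnorm_square)
qed

lemma isometry_scalar_prod_self:
  fixes Q :: "real mat"
  assumes "Q \<in> carrier_mat p p" and "transpose_mat Q * Q = 1\<^sub>m p" and "v \<in> carrier_vec p"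
  shows "(Q *\<^sub>v v) \<bullet> (Q *\<^sub>v v) = v \<bullet> v"
proof -
  have "(transpose_mat Q *\<^sub>v (Q *\<^sub>v v)) \<bullet> v = (Q *\<^sub>v v) \<bullet> (Q *\<^sub>v v)"
    using transpose_vec_mult_scalar[of Q p p v "Q *\<^sub>v v"] assms by simp
  moreover have "transpose_mat Q *\<^sub>v (Q *\<^sub>v v) = v"
    using assms
    by (metis assoc_mult_mat_vec one_mult_mat_vec transpose_carrier_mat)
  ultimately show ?thesis by simp
qed

lemma invertible_mat_det_nonzero:
  fixes A :: "real mat"
  assumes "invertible_mat A" and A: "A \<in> carrier_mat n n"
  shows "det A \<noteq> 0"
proof -
  from assms obtain B where AB: "A * B = 1\<^sub>m n" and BA: "B * A = 1\<^sub>m (dim_row B)"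
    by (auto simp: invertible_mat_def inverts_mat_def)
  have "dim_col B = n" using arg_cong[OF AB, of dim_col] by simp
  moreover have "dim_row B = n" using arg_cong[OF BA, of dim_col] A by simp
  ultimately have "det A * det B = 1"
    using det_mult[OF A, of B] AB by auto
  then show ?thesis by auto
qed

lemma det_nonzero_solve:
  fixes A :: "real mat"
  assumes A: "A \<in> carrier_mat n n" and "det A \<noteq> 0" and b: "b \<in> carrier_vec n"
  obtains z where "z \<in> carrier_vec n" and "A *\<^sub>v z = b"
proof -
  have "A \<in> Units (ring_mat TYPE(real) n undefined)"
    using det_non_zero_imp_unit[OF A assms(2)] .
  then obtain B where B: "B \<in> carrier_mat n n" "A * B = 1\<^sub>m n"
    by (auto simp: Units_def ring_mat_def)
  then have "A *\<^sub>v (B *\<^sub>v b) = b"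
    using A b by (metis assoc_mult_mat_vec one_mult_mat_vec)
  then show ?thesis using that B b by (meson mult_mat_vec_carrier)
qed

text \<open>Pythagoras for the two block rows of the factor.\<close>
lemma partial_R_factor_norm_split:
  assumes QR: "partial_R_factor k A R\<^sub>1\<^sub>1 R\<^sub>1\<^sub>2 R\<^sub>2\<^sub>2" and A: "A \<in> carrier_mat p n"
    and z: "z \<in> carrier_vec k" and u: "u \<in> carrier_vec (n - k)"
  shows "(A *\<^sub>v (z @\<^sub>v u)) \<bullet> (A *\<^sub>v (z @\<^sub>v u)) =
    (R\<^sub>1\<^sub>1 *\<^sub>v z + R\<^sub>1\<^sub>2 *\<^sub>v u) \<bullet> (R\<^sub>1\<^sub>1 *\<^sub>v z + R\<^sub>1\<^sub>2 *\<^sub>v u) + (R\<^sub>2\<^sub>2 *\<^sub>v u) \<bullet> (R\<^sub>2\<^sub>2 *\<^sub>v u)"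
proof -
  from QR A obtain Q where k: "k \<le> p" "k \<le> n"
    and Q: "Q \<in> carrier_mat p p" "transpose_mat Q * Q = 1\<^sub>m p"
    and R: "R\<^sub>1\<^sub>1 \<in> carrier_mat k k" "R\<^sub>1\<^sub>2 \<in> carrier_mat k (n - k)"
      "R\<^sub>2\<^sub>2 \<in> carrier_mat (p - k) (n - k)"
    and AQ: "A = Q * four_block_mat R\<^sub>1\<^sub>1 R\<^sub>1\<^sub>2 (0\<^sub>m (p - k) k) R\<^sub>2\<^sub>2"
    by (auto simp: partial_R_factor_def partial_QR_def Let_def)
  let ?F = "four_block_mat R\<^sub>1\<^sub>1 R\<^sub>1\<^sub>2 (0\<^sub>m (p - k) k) R\<^sub>2\<^sub>2"
  let ?s = "R\<^sub>1\<^sub>1 *\<^sub>v z + R\<^sub>1\<^sub>2 *\<^sub>v u" and ?t = "R\<^sub>2\<^sub>2 *\<^sub>v u"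
  have s: "?s \<in> carrier_vec k" and t: "?t \<in> carrier_vec (p - k)"
    using R z u by auto
  have F: "?F \<in> carrier_mat p n"
    using four_block_carrier_mat[OF R(1,3), of R\<^sub>1\<^sub>2 "0\<^sub>m (p - k) k"] k by simp
  have x: "z @\<^sub>v u \<in> carrier_vec n"
    using append_carrier_vec[OF z u] k by simp
  have Fx: "?F *\<^sub>v (z @\<^sub>v u) = ?s @\<^sub>v ?t"
  proof -
    have "0\<^sub>m (p - k) k *\<^sub>v z + ?t = ?t"
      using R(3) z t by (intro eq_vecI) (auto simp: scalar_prod_def)
    then show ?thesis
      using four_block_mat_mult_vec[OF R(1,2) zero_carrier_mat R(3) z u] by simp
  qed
  have "A *\<^sub>v (z @\<^sub>v u) = Q *\<^sub>v (?s @\<^sub>v ?t)"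
    using assoc_mult_mat_vec[OF Q(1) F x] AQ Fx by simp
  moreover have "?s @\<^sub>v ?t \<in> carrier_vec p"
    using append_carrier_vec[OF s t] k by simp
  ultimately show ?thesis
    using isometry_scalar_prod_self[OF Q] scalar_prod_append[OF s t s t] by simp
qed

lemma partial_R_factor_dims:
  assumes "partial_R_factor k A R\<^sub>1\<^sub>1 R\<^sub>1\<^sub>2 R\<^sub>2\<^sub>2" and "A \<in> carrier_mat p n"
  shows "k \<le> n" and "R\<^sub>1\<^sub>1 \<in> carrier_mat k k" and "R\<^sub>1\<^sub>2 \<in> carrier_mat k (n - k)"
    and "R\<^sub>2\<^sub>2 \<in> carrier_mat (p - k) (n - k)"
  using assms by (auto simp: partial_R_factor_def partial_QR_def Let_def)

text \<open>Choose \<open>z\<close> optimal for \<open>A\<close>, so that \<open>R\<^sub>1\<^sub>1 z + R\<^sub>1\<^sub>2 u\<close> vanishes. For the same \<open>z\<close>, the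
  squared norm of \<open>B (z, u)\<close> is at least \<open>|S\<^sub>2\<^sub>2 u|\<^sup>2\<close>, and the assumed bound compares the two.\<close>
lemma trailing_block_mono:
  assumes QR: "partial_R_factor k A R\<^sub>1\<^sub>1 R\<^sub>1\<^sub>2 R\<^sub>2\<^sub>2" and A: "A \<in> carrier_mat p n"
    and QR': "partial_R_factor k B S\<^sub>1\<^sub>1 S\<^sub>1\<^sub>2 S\<^sub>2\<^sub>2" and B: "B \<in> carrier_mat q n"
    and det: "det R\<^sub>1\<^sub>1 \<noteq> 0"
    and le: "\<And>x. x \<in> carrier_vec n \<Longrightarrow> (B *\<^sub>v x) \<bullet> (B *\<^sub>v x) \<le> c * ((A *\<^sub>v x) \<bullet> (A *\<^sub>v x))"
    and u: "u \<in> carrier_vec (n - k)"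
  shows "(S\<^sub>2\<^sub>2 *\<^sub>v u) \<bullet> (S\<^sub>2\<^sub>2 *\<^sub>v u) \<le> c * ((R\<^sub>2\<^sub>2 *\<^sub>v u) \<bullet> (R\<^sub>2\<^sub>2 *\<^sub>v u))"
proof -
  note R = partial_R_factor_dims[OF QR A]
  have b: "R\<^sub>1\<^sub>2 *\<^sub>v u \<in> carrier_vec k" using R u by auto
  then obtain z where z: "z \<in> carrier_vec k" and sol: "R\<^sub>1\<^sub>1 *\<^sub>v z = - (R\<^sub>1\<^sub>2 *\<^sub>v u)"
    using det_nonzero_solve[OF R(2) det, of "- (R\<^sub>1\<^sub>2 *\<^sub>v u)"] by auto
  have "R\<^sub>1\<^sub>1 *\<^sub>v z + R\<^sub>1\<^sub>2 *\<^sub>v u = 0\<^sub>v k"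
    unfolding sol using b by simp
  then have opt: "(A *\<^sub>v (z @\<^sub>v u)) \<bullet> (A *\<^sub>v (z @\<^sub>v u)) = (R\<^sub>2\<^sub>2 *\<^sub>v u) \<bullet> (R\<^sub>2\<^sub>2 *\<^sub>v u)"
    using partial_R_factor_norm_split[OF QR A z u] by simp
  have "z @\<^sub>v u \<in> carrier_vec n"
    using append_carrier_vec[OF z u] R(1) by simp
  then have "(B *\<^sub>v (z @\<^sub>v u)) \<bullet> (B *\<^sub>v (z @\<^sub>v u)) \<le> c * ((R\<^sub>2\<^sub>2 *\<^sub>v u) \<bullet> (R\<^sub>2\<^sub>2 *\<^sub>v u))"
    using le opt by fastforce
  moreover have "(S\<^sub>2\<^sub>2 *\<^sub>v u) \<bullet> (S\<^sub>2\<^sub>2 *\<^sub>v u) \<le> (B *\<^sub>v (z @\<^sub>v u)) \<bullet> (B *\<^sub>v (z @\<^sub>v u))"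
    using partial_R_factor_norm_split[OF QR' B z u] scalar_prod_self_nonneg by simp
  ultimately show ?thesis by linarith
qed

text \<open>The leading block is singular exactly when \<open>A\<close> kills a nonzero vector supported on the first
  \<open>k\<close> coordinates, and the bound passes such a vector from \<open>B\<close> to \<open>A\<close>.\<close>
lemma leading_block_det_transfer:
  assumes QR: "partial_R_factor k A R\<^sub>1\<^sub>1 R\<^sub>1\<^sub>2 R\<^sub>2\<^sub>2" and A: "A \<in> carrier_mat p n"
    and QR': "partial_R_factor k B S\<^sub>1\<^sub>1 S\<^sub>1\<^sub>2 S\<^sub>2\<^sub>2" and B: "B \<in> carrier_mat q n"
    and det: "det R\<^sub>1\<^sub>1 \<noteq> 0"
    and le: "\<And>x. x \<in> carrier_vec n \<Longrightarrow> (A *\<^sub>v x) \<bullet> (A *\<^sub>v x) \<le> c * ((B *\<^sub>v x) \<bullet> (B *\<^sub>v x))"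
  shows "det S\<^sub>1\<^sub>1 \<noteq> 0"
proof
  note R = partial_R_factor_dims[OF QR A] and S = partial_R_factor_dims[OF QR' B]
  let ?u = "0\<^sub>v (n - k) :: real vec"
  have u: "?u \<in> carrier_vec (n - k)" by simp
  have zero: "T *\<^sub>v ?u = 0\<^sub>v r" if "T \<in> carrier_mat r (n - k)" for T r
    using that by (intro eq_vecI) (auto simp: scalar_prod_def)
  have split_A: "(A *\<^sub>v (z @\<^sub>v ?u)) \<bullet> (A *\<^sub>v (z @\<^sub>v ?u)) = (R\<^sub>1\<^sub>1 *\<^sub>v z) \<bullet> (R\<^sub>1\<^sub>1 *\<^sub>v z)"
    if z: "z \<in> carrier_vec k" for z
    using partial_R_factor_norm_split[OF QR A z u] zero[OF R(3)] zero[OF R(4)] R z by simp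
  have split_B: "(B *\<^sub>v (z @\<^sub>v ?u)) \<bullet> (B *\<^sub>v (z @\<^sub>v ?u)) = (S\<^sub>1\<^sub>1 *\<^sub>v z) \<bullet> (S\<^sub>1\<^sub>1 *\<^sub>v z)"
    if z: "z \<in> carrier_vec k" for z
    using partial_R_factor_norm_split[OF QR' B z u] zero[OF S(3)] zero[OF S(4)] S z by simp
  assume "det S\<^sub>1\<^sub>1 = 0"
  then obtain z where z: "z \<in> carrier_vec k" "z \<noteq> 0\<^sub>v k" and Sz: "S\<^sub>1\<^sub>1 *\<^sub>v z = 0\<^sub>v k"
    using det_0_iff_vec_prod_zero[OF S(2)] by auto
  have "z @\<^sub>v ?u \<in> carrier_vec n"
    using append_carrier_vec[OF z(1) u] R(1) by simp
  then have "(R\<^sub>1\<^sub>1 *\<^sub>v z) \<bullet> (R\<^sub>1\<^sub>1 *\<^sub>v z) \<le> c * ((S\<^sub>1\<^sub>1 *\<^sub>v z) \<bullet> (S\<^sub>1\<^sub>1 *\<^sub>v z))"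
    using le split_A[OF z(1)] split_B[OF z(1)] by fastforce
  then have "(R\<^sub>1\<^sub>1 *\<^sub>v z) \<bullet> (R\<^sub>1\<^sub>1 *\<^sub>v z) = 0"
    using Sz scalar_prod_self_nonneg[of "R\<^sub>1\<^sub>1 *\<^sub>v z"] by simp
  then have "R\<^sub>1\<^sub>1 *\<^sub>v z = 0\<^sub>v k"
    using scalar_prod_self_eq_0 R(2) z(1) by (meson mult_mat_vec_carrier)
  then show False
    using det_0_iff_vec_prod_zero[OF R(2)] z det by blast
qed

lemma eps_embedding_norm_bounds:
  assumes "eps_embedding \<epsilon> \<Omega> V" and "x \<in> V"
  shows "(\<Omega> *\<^sub>v x) \<bullet> (\<Omega> *\<^sub>v x) \<le> (1 + \<epsilon>) * (x \<bullet> x)"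
    and "(1 - \<epsilon>) * (x \<bullet> x) \<le> (\<Omega> *\<^sub>v x) \<bullet> (\<Omega> *\<^sub>v x)"
proof -
  have "\<bar>(\<Omega> *\<^sub>v x) \<bullet> (\<Omega> *\<^sub>v x) - x \<bullet> x\<bar> \<le> \<epsilon> * (x \<bullet> x)"
    using assms unfolding eps_embedding_def
    by (metis mult.assoc power2_eq_square vnorm_square)
  then show "(\<Omega> *\<^sub>v x) \<bullet> (\<Omega> *\<^sub>v x) \<le> (1 + \<epsilon>) * (x \<bullet> x)"
    and "(1 - \<epsilon>) * (x \<bullet> x) \<le> (\<Omega> *\<^sub>v x) \<bullet> (\<Omega> *\<^sub>v x)"
    by (auto simp: algebra_simps abs_le_iff)
qed

theorem theorem4p2:
  fixes M \<Omega> P R\<^sub>1\<^sub>1 R\<^sub>1\<^sub>2 R\<^sub>2\<^sub>2 Rsk\<^sub>1\<^sub>1 Rsk\<^sub>1\<^sub>2 Rsk\<^sub>2\<^sub>2 :: "real mat" and \<epsilon> :: real and m n d k :: nat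
  assumes "M \<in> carrier_mat m n"
    and "\<Omega> \<in> carrier_mat d m"
    and "\<epsilon> < 1"
    and "eps_embedding \<epsilon> \<Omega> (vec_space.col_space m M)"
    and "permutation_matrix n P"
    and "partial_R_factor k (M * P) R\<^sub>1\<^sub>1 R\<^sub>1\<^sub>2 R\<^sub>2\<^sub>2"
    and "partial_R_factor k (\<Omega> * M * P) Rsk\<^sub>1\<^sub>1 Rsk\<^sub>1\<^sub>2 Rsk\<^sub>2\<^sub>2"
    and "invertible_mat R\<^sub>1\<^sub>1"
  shows "\<forall>j. 1 \<le> j \<and> j \<le> n - k \<longrightarrow>
           1 / (1 + \<epsilon>) * (colnorm j Rsk\<^sub>2\<^sub>2)\<^sup>2 \<le> (colnorm j R\<^sub>2\<^sub>2)\<^sup>2 \<and>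
           (colnorm j R\<^sub>2\<^sub>2)\<^sup>2 \<le> 1 / (1 - \<epsilon>) * (colnorm j Rsk\<^sub>2\<^sub>2)\<^sup>2"
proof (intro allI impI)
  fix j assume j: "1 \<le> j \<and> j \<le> n - k"
  note M = assms(1) and \<Omega> = assms(2) and QR = assms(6) and QRsk = assms(7)
  let ?A = "M * P" and ?B = "\<Omega> * M * P"
  have P: "P \<in> carrier_mat n n"
    using assms(5) by (auto simp: permutation_matrix_def)
  have A: "?A \<in> carrier_mat m n" and B: "?B \<in> carrier_mat d n"
    using M \<Omega> P by auto
  have bounds: "(?B *\<^sub>v x) \<bullet> (?B *\<^sub>v x) \<le> (1 + \<epsilon>) * ((?A *\<^sub>v x) \<bullet> (?A *\<^sub>v x))"
    "(1 - \<epsilon>) * ((?A *\<^sub>v x) \<bullet> (?A *\<^sub>v x)) \<le> (?B *\<^sub>v x) \<bullet> (?B *\<^sub>v x)"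
    if x: "x \<in> carrier_vec n" for x
  proof -
    have "?A *\<^sub>v x = M *\<^sub>v (P *\<^sub>v x)"
      using M P x by simp
    moreover have "M *\<^sub>v (P *\<^sub>v x) \<in> vec_space.col_space m M"
      unfolding vec_space.col_space_eq[OF M] using M P x by auto
    ultimately have "?A *\<^sub>v x \<in> vec_space.col_space m M"
      by simp
    moreover have "?B *\<^sub>v x = \<Omega> *\<^sub>v (?A *\<^sub>v x)"
      using assoc_mult_mat_vec[OF \<Omega> A x] by (simp only: assoc_mult_mat[OF \<Omega> M P])
    ultimately show "(?B *\<^sub>v x) \<bullet> (?B *\<^sub>v x) \<le> (1 + \<epsilon>) * ((?A *\<^sub>v x) \<bullet> (?A *\<^sub>v x))"
      "(1 - \<epsilon>) * ((?A *\<^sub>v x) \<bullet> (?A *\<^sub>v x)) \<le> (?B *\<^sub>v x) \<bullet> (?B *\<^sub>v x)"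
      using eps_embedding_norm_bounds[OF assms(4)] by simp_all
  qed
  have inverse_bound: "(?A *\<^sub>v x) \<bullet> (?A *\<^sub>v x) \<le> 1 / (1 - \<epsilon>) * ((?B *\<^sub>v x) \<bullet> (?B *\<^sub>v x))"
    if "x \<in> carrier_vec n" for x
    using bounds(2)[OF that] assms(3) by (simp add: field_simps)
  have det: "det R\<^sub>1\<^sub>1 \<noteq> 0"
    using invertible_mat_det_nonzero[OF assms(8) partial_R_factor_dims(2)[OF QR A]] .
  have det_sk: "det Rsk\<^sub>1\<^sub>1 \<noteq> 0"
    using leading_block_det_transfer[OF QR A QRsk B det inverse_bound] .
  let ?u = "unit_vec (n - k) (j - 1) :: real vec"
  have u: "?u \<in> carrier_vec (n - k)" by simp
  have cols: "(colnorm j R\<^sub>2\<^sub>2)\<^sup>2 = (R\<^sub>2\<^sub>2 *\<^sub>v ?u) \<bullet> (R\<^sub>2\<^sub>2 *\<^sub>v ?u)"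
    "(colnorm j Rsk\<^sub>2\<^sub>2)\<^sup>2 = (Rsk\<^sub>2\<^sub>2 *\<^sub>v ?u) \<bullet> (Rsk\<^sub>2\<^sub>2 *\<^sub>v ?u)"
    using colnorm_square[OF partial_R_factor_dims(4)[OF QR A]]
      colnorm_square[OF partial_R_factor_dims(4)[OF QRsk B]] j by auto
  have upper: "(colnorm j Rsk\<^sub>2\<^sub>2)\<^sup>2 \<le> (1 + \<epsilon>) * (colnorm j R\<^sub>2\<^sub>2)\<^sup>2"
    unfolding cols by (rule trailing_block_mono[OF QR A QRsk B det bounds(1) u])
  have "1 / (1 + \<epsilon>) * (colnorm j Rsk\<^sub>2\<^sub>2)\<^sup>2 \<le> (colnorm j R\<^sub>2\<^sub>2)\<^sup>2"
  proof (cases "1 + \<epsilon> > 0")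
    case True
    then show ?thesis using upper by (simp add: field_simps)
  next
    case False
    \<comment> \<open>The case \<open>\<epsilon> \<le> -1\<close>: the upper bound is nonpositive, so the sketched column vanishes.\<close>
    then have "(1 + \<epsilon>) * (colnorm j R\<^sub>2\<^sub>2)\<^sup>2 \<le> 0"
      by (intro mult_nonpos_nonneg) auto
    with upper have "(colnorm j Rsk\<^sub>2\<^sub>2)\<^sup>2 = 0"
      using zero_le_power2[of "colnorm j Rsk\<^sub>2\<^sub>2"] by linarith
    then show ?thesis by simp
  qed
  moreover have "(colnorm j R\<^sub>2\<^sub>2)\<^sup>2 \<le> 1 / (1 - \<epsilon>) * (colnorm j Rsk\<^sub>2\<^sub>2)\<^sup>2"
    unfolding cols by (rule trailing_block_mono[OF QRsk B QR A det_sk inverse_bound u])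
  ultimately show "1 / (1 + \<epsilon>) * (colnorm j Rsk\<^sub>2\<^sub>2)\<^sup>2 \<le> (colnorm j R\<^sub>2\<^sub>2)\<^sup>2 \<and>
      (colnorm j R\<^sub>2\<^sub>2)\<^sup>2 \<le> 1 / (1 - \<epsilon>) * (colnorm j Rsk\<^sub>2\<^sub>2)\<^sup>2" by blast
qed

end
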